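(* Let $n\ge3$, let $L_1,\ldots,L_n$ be positive real numbers and let $m\ge2$. The inequalities $$L_k\le L_1+\cdots+\widehat{L_k}+\cdots+L_n,\qquad k=1,\ldots,n,$$ (the hat meaning that the term $L_k$ is omitted) are necessary and sufficient for the existence of an $n$-gon in the hyperbolic space $\mathbb{H}^m$ of dimension $m$ with sidelengths $L_1,\ldots,L_n$.
   Context: An $n$-gon in $\mathbb{H}^m$ (real hyperbolic space of constant curvature $-1$, with distance $d$) is a list of points $Z_1,\ldots,Z_n\in\mathbb{H}^m$ with $Z_k\ne Z_{k+1}$ for all $k$, indices counted modulo $n$ (so $Z_{n+1}=Z_1$). No convexity, simplicity or distinctness of non-consecutive vertices is required. Its sidelengths are $L_k=d(Z_k,Z_{k+1})$, $k=1,\ldots,n$. *)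

theory Defs
  imports "HOL-Analysis.Analysis"
begin

text \<open>
  Real hyperbolic space of curvature -1 and dimension \<open>CARD('m)\<close>, in the hyperboloid model: a point
  \<open>(x, t)\<close> of Minkowski space has spatial part \<open>x\<close> in \<open>real ^ 'm\<close> and time coordinate \<open>t\<close>, and
  the space is the upper sheet of \<open>x \<bullet> x - t * t = -1\<close>.
\<close>

definition lorentz :: "(real ^ 'm) \<times> real \<Rightarrow> (real ^ 'm) \<times> real \<Rightarrow> real" where
  "lorentz p q = fst p \<bullet> fst q - snd p * snd q"

definition hyperbolic_space :: "((real ^ 'm) \<times> real) set" where
  "hyperbolic_space = {p. lorentz p p = -1 \<and> snd p > 0}"

text \<open>On \<open>hyperbolic_space\<close> one has \<open>- lorentz p q \<ge> 1\<close>, where \<open>arcosh\<close> is the inverse of \<open>cosh\<close>.\<close>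

definition hyp_dist :: "(real ^ 'm) \<times> real \<Rightarrow> (real ^ 'm) \<times> real \<Rightarrow> real" where
  "hyp_dist p q = arcosh (- lorentz p q)"

text \<open>Vertices are numbered \<open>0, \<dots>, n - 1\<close> and the successor of an index is taken modulo \<open>n\<close>.\<close>

definition hyp_polygon :: "nat \<Rightarrow> ((real ^ 'm) \<times> real) list \<Rightarrow> bool" where
  "hyp_polygon n Z \<longleftrightarrow>
     length Z = n \<and> set Z \<subseteq> hyperbolic_space \<and> (\<forall>k<n. Z ! k \<noteq> Z ! (Suc k mod n))"

definition sidelength :: "((real ^ 'm) \<times> real) list \<Rightarrow> nat \<Rightarrow> real" where
  "sidelength Z k = hyp_dist (Z ! k) (Z ! (Suc k mod length Z))"

end

theory Submission
  imports Defs
begin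

text \<open>
  Necessity is the triangle inequality: walking around the polygon from one end of a side to the
  other end uses precisely the other sides. In the hyperboloid model the triangle inequality
  \<open>d(p, r) \<le> d(p, q) + d(q, r)\<close> comes from splitting \<open>p\<close> and \<open>r\<close> into their components
  along \<open>q\<close> and Lorentz-orthogonal to \<open>q\<close>. The Lorentz form is positive definite on the orthogonal
  complement of the timelike vector \<open>q\<close> (\<open>lorentz_orthogonal_pos\<close>), so the Cauchy-Schwarz inequality
  there turns into the addition theorem of \<open>cosh\<close>.

  For sufficiency, fix the last side as a segment from \<open>p\<close> to \<open>q\<close> and join its ends by a path
  with the other lengths (\<open>exists_hyperbolic_path\<close>). Such a path exists by induction on the number of
  steps: choose the last but one vertex \<open>r\<close> at the prescribed distance from \<open>q\<close> and at a distance
  from \<open>p\<close> for which the triangle \<open>p, r, q\<close> can be built and for which the remaining steps again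
  satisfy the polygon inequalities. Both requirements confine \<open>d(p, r)\<close> to intervals, and these
  overlap precisely because of the polygon inequalities for the whole path. What remains is the case
  of triangles (\<open>exists_hyperbolic_triangle\<close>). There the distances to \<open>p\<close> and \<open>q\<close> determine the
  component of \<open>r\<close> in the plane spanned by \<open>p\<close> and \<open>q\<close>, and the triangle inequalities say that the
  Gram determinant has the sign which leaves a nonnegative square for the component of \<open>r\<close> along a
  unit vector orthogonal to that plane. In dimension at least two there is such a vector.
\<close>

section \<open>The Lorentz form\<close>

lemma lorentz_commute: "lorentz p q = lorentz q p"
  by (simp add: lorentz_def inner_commute mult.commute)

lemma lorentz_add_left: "lorentz (p + q) r = lorentz p r + lorentz q r"
  by (simp add: lorentz_def inner_add_left algebra_simps)

lemma lorentz_scaleR_left: "lorentz (c *\<^sub>R p) q = c * lorentz p q"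
  by (simp add: lorentz_def algebra_simps)

lemma lorentz_add_right: "lorentz r (p + q) = lorentz r p + lorentz r q"
  by (simp add: lorentz_def inner_add_right algebra_simps)

lemma lorentz_scaleR_right: "lorentz p (c *\<^sub>R q) = c * lorentz p q"
  by (simp add: lorentz_def algebra_simps)

lemma lorentz_diff_left: "lorentz (p - q) r = lorentz p r - lorentz q r"
  by (simp add: lorentz_def inner_diff_left algebra_simps)

lemma lorentz_diff_right: "lorentz r (p - q) = lorentz r p - lorentz r q"
  by (simp add: lorentz_def inner_diff_right algebra_simps)

lemmas lorentz_bilinear =
  lorentz_diff_left lorentz_diff_right
  lorentz_add_left lorentz_add_right lorentz_scaleR_left lorentz_scaleR_right

lemma hyperbolic_spaceD:
  assumes "p \<in> hyperbolic_space"
  shows "lorentz p p = -1" "snd p > 0"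
  using assms by (simp_all add: hyperbolic_space_def)

lemma norm_fst_less_snd:
  assumes "p \<in> hyperbolic_space"
  shows "norm (fst p) < snd p"
proof -
  have "(norm (fst p))\<^sup>2 = (snd p)\<^sup>2 - 1"
    using hyperbolic_spaceD(1)[OF assms]
    by (simp add: lorentz_def dot_square_norm flip: power2_eq_square)
  then have "(norm (fst p))\<^sup>2 < (snd p)\<^sup>2"
    by simp
  then show ?thesis
    using hyperbolic_spaceD(2)[OF assms] by (meson less_imp_le power2_less_imp_less)
qed

text \<open>
  A vector orthogonal to a timelike vector \<open>p\<close> is spacelike: by Cauchy-Schwarz in the spatial part
  the modulus of its time coordinate is at most its spatial norm times \<open>norm (fst p) / snd p < 1\<close>.
\<close>

lemma lorentz_orthogonal_pos:
  assumes p: "p \<in> hyperbolic_space" and orth: "lorentz p v = 0" and "v \<noteq> 0"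
  shows "lorentz v v > 0"
proof -
  have eq: "fst p \<bullet> fst v = snd p * snd v"
    using orth by (simp add: lorentz_def)
  have t: "snd p > 0" "norm (fst p) < snd p"
    using hyperbolic_spaceD(2)[OF p] norm_fst_less_snd[OF p] by simp_all
  have nz: "fst v \<noteq> 0"
  proof
    assume "fst v = 0"
    then have "snd v = 0" using eq t by simp
    with \<open>fst v = 0\<close> \<open>v \<noteq> 0\<close> show False by (simp add: prod_eq_iff)
  qed
  have "snd p * \<bar>snd v\<bar> = \<bar>fst p \<bullet> fst v\<bar>"
    using eq t by (simp add: abs_mult)
  also have "\<dots> \<le> norm (fst p) * norm (fst v)"
    by (rule Cauchy_Schwarz_ineq2)
  also have "\<dots> < snd p * norm (fst v)"
    using t nz by (simp add: mult_strict_right_mono)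
  finally have "\<bar>snd v\<bar> < norm (fst v)"
    using t by simp
  then have "\<bar>snd v\<bar>\<^sup>2 < (norm (fst v))\<^sup>2"
    by (intro power_strict_mono) simp_all
  then show ?thesis
    by (simp add: lorentz_def dot_square_norm flip: power2_eq_square)
qed

lemma lorentz_orthogonal_nonneg:
  assumes "p \<in> hyperbolic_space" and "lorentz p v = 0"
  shows "lorentz v v \<ge> 0"
  using lorentz_orthogonal_pos[OF assms] by (cases "v = 0") (auto simp: lorentz_def)

lemma lorentz_orthogonal_Cauchy_Schwarz:
  assumes p: "p \<in> hyperbolic_space" and u: "lorentz p u = 0" and v: "lorentz p v = 0"
  shows "(lorentz u v)\<^sup>2 \<le> lorentz u u * lorentz v v"
proof (cases "v = 0")
  case True
  then show ?thesis by (simp add: lorentz_def)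
next
  case False
  \<comment> \<open>Up to the factor \<open>lorentz v v\<close>, the part of \<open>u\<close> orthogonal to \<open>v\<close>.\<close>
  define w where "w = lorentz v v *\<^sub>R u - lorentz u v *\<^sub>R v"
  have "lorentz p w = 0"
    by (simp add: w_def lorentz_bilinear u v)
  then have "0 \<le> lorentz w w"
    by (rule lorentz_orthogonal_nonneg[OF p])
  also have "lorentz w w = lorentz v v * (lorentz u u * lorentz v v - (lorentz u v)\<^sup>2)"
    by (simp add: w_def lorentz_bilinear lorentz_commute[of v u] algebra_simps power2_eq_square)
  finally show ?thesis
    using lorentz_orthogonal_pos[OF p v False] by (simp add: zero_le_mult_iff)
qed

section \<open>The hyperbolic distance\<close>

lemma lorentz_neg:
  assumes p: "p \<in> hyperbolic_space" and q: "q \<in> hyperbolic_space"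
  shows "lorentz p q < 0"
proof -
  have "fst p \<bullet> fst q \<le> norm (fst p) * norm (fst q)"
    by (rule norm_cauchy_schwarz)
  also have "\<dots> < snd p * snd q"
    using norm_fst_less_snd[OF p] norm_fst_less_snd[OF q] by (simp add: mult_strict_mono')
  finally show ?thesis by (simp add: lorentz_def)
qed

text \<open>
  The reversed Cauchy-Schwarz inequality for timelike vectors: the component of \<open>q\<close> orthogonal to \<open>p\<close>
  has the nonnegative square \<open>(lorentz p q)\<^sup>2 - 1\<close>.
\<close>

lemma lorentz_le_minus_one:
  assumes p: "p \<in> hyperbolic_space" and q: "q \<in> hyperbolic_space"
  shows "lorentz p q \<le> -1"
proof -
  define v where "v = q + lorentz p q *\<^sub>R p"
  have pp: "lorentz p p = -1" and qq: "lorentz q q = -1"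
    using p q by (simp_all add: hyperbolic_spaceD)
  have "lorentz p v = 0"
    by (simp add: v_def lorentz_bilinear pp)
  then have "0 \<le> lorentz v v"
    by (rule lorentz_orthogonal_nonneg[OF p])
  also have "lorentz v v = (lorentz p q)\<^sup>2 - 1"
    by (simp add: v_def lorentz_bilinear pp qq lorentz_commute[of q p] power2_eq_square)
  finally have "1 \<le> \<bar>lorentz p q\<bar>"
    using abs_le_square_iff[of 1 "lorentz p q"] by simp
  with lorentz_neg[OF p q] show ?thesis by simp
qed

lemma cosh_hyp_dist:
  assumes "p \<in> hyperbolic_space" and "q \<in> hyperbolic_space"
  shows "cosh (hyp_dist p q) = - lorentz p q"
  using lorentz_le_minus_one[OF assms] by (simp add: hyp_dist_def)

lemma hyp_dist_nonneg:
  assumes "p \<in> hyperbolic_space" and "q \<in> hyperbolic_space"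
  shows "hyp_dist p q \<ge> 0"
  using lorentz_le_minus_one[OF assms] by (simp add: hyp_dist_def)

lemma hyp_dist_eqI:
  assumes "lorentz p q = - cosh x" and "x \<ge> 0"
  shows "hyp_dist p q = x"
  using assms by (simp add: hyp_dist_def arcosh_cosh_real)

lemma hyp_dist_commute: "hyp_dist p q = hyp_dist q p"
  by (simp add: hyp_dist_def lorentz_commute)

lemma hyp_dist_self: "p \<in> hyperbolic_space \<Longrightarrow> hyp_dist p p = 0"
  by (rule hyp_dist_eqI) (simp_all add: hyperbolic_spaceD)

text \<open>
  The components \<open>u\<close>, \<open>v\<close> of \<open>p\<close>, \<open>r\<close> orthogonal to \<open>q\<close> have lengths \<open>sinh d(p, q)\<close> and
  \<open>sinh d(q, r)\<close>. Hence \<open>lorentz u v = cosh d(p, q) * cosh d(q, r) - cosh d(p, r)\<close> (the law of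
  cosines) is at least \<open>- sinh d(p, q) * sinh d(q, r)\<close>.
\<close>

lemma hyp_dist_triangle:
  assumes p: "p \<in> hyperbolic_space" and q: "q \<in> hyperbolic_space" and r: "r \<in> hyperbolic_space"
  shows "hyp_dist p r \<le> hyp_dist p q + hyp_dist q r"
proof -
  let ?x = "hyp_dist p q" and ?y = "hyp_dist q r"
  define u where "u = p - cosh ?x *\<^sub>R q"
  define v where "v = r - cosh ?y *\<^sub>R q"
  have [simp]: "lorentz p p = -1" "lorentz q q = -1" "lorentz r r = -1"
    using p q r by (simp_all add: hyperbolic_spaceD)
  have [simp]: "lorentz p q = - cosh ?x" "lorentz q p = - cosh ?x"
    "lorentz q r = - cosh ?y" "lorentz r q = - cosh ?y"
    using cosh_hyp_dist[OF p q] cosh_hyp_dist[OF q r]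
    by (simp_all add: lorentz_commute[of q p] lorentz_commute[of r q])
  have orth: "lorentz q u = 0" "lorentz q v = 0"
    by (simp_all add: u_def v_def lorentz_bilinear)
  have uu: "lorentz u u = (sinh ?x)\<^sup>2" and vv: "lorentz v v = (sinh ?y)\<^sup>2"
    by (simp_all add: u_def v_def lorentz_bilinear sinh_square_eq) (simp_all add: power2_eq_square)
  have uv: "lorentz u v = lorentz p r + cosh ?x * cosh ?y"
    by (simp add: u_def v_def lorentz_bilinear)
  have "(lorentz u v)\<^sup>2 \<le> (sinh ?x * sinh ?y)\<^sup>2"
    using lorentz_orthogonal_Cauchy_Schwarz[OF q orth] by (simp add: uu vv power_mult_distrib)
  then have "\<bar>lorentz u v\<bar> \<le> sinh ?x * sinh ?y"
    using hyp_dist_nonneg[OF p q] hyp_dist_nonneg[OF q r]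
    by (simp add: abs_le_square_iff[symmetric] abs_mult)
  then have "cosh (hyp_dist p r) \<le> cosh (?x + ?y)"
    by (simp add: cosh_hyp_dist[OF p r] cosh_add uv)
  then show ?thesis
    using hyp_dist_nonneg[OF p q] hyp_dist_nonneg[OF q r] hyp_dist_nonneg[OF p r]
    by (simp add: cosh_real_nonneg_le_iff)
qed

lemma hyp_dist_le_path:
  assumes "\<And>i. i \<le> k \<Longrightarrow> f i \<in> hyperbolic_space"
  shows "hyp_dist (f 0) (f k) \<le> (\<Sum>i<k. hyp_dist (f i) (f (Suc i)))"
  using assms
proof (induction k)
  case 0
  then show ?case by (simp add: hyp_dist_self)
next
  case (Suc k)
  then show ?case
    using hyp_dist_triangle[of "f 0" "f k" "f (Suc k)"] by fastforce
qed

section \<open>Construction of triangles\<close>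

text \<open>
  For a vector \<open>(x, s)\<close>, orthogonality to \<open>p\<close> and to \<open>q\<close> prescribes \<open>s\<close> twice, as
  \<open>fst p \<bullet> x / snd p\<close> and as \<open>fst q \<bullet> x / snd q\<close>. The two values agree when \<open>x\<close> is orthogonal to one
  particular Euclidean vector, and in dimension at least two some nonzero \<open>x\<close> is.
\<close>

lemma exists_unit_orthogonal:
  fixes p q :: "(real ^ 'm) \<times> real"
  assumes p: "p \<in> hyperbolic_space" and q: "q \<in> hyperbolic_space" and "CARD('m) \<ge> 2"
  obtains e :: "(real ^ 'm) \<times> real"
  where "lorentz p e = 0" "lorentz q e = 0" "lorentz e e = 1"
proof -
  have t: "snd p > 0" "snd q > 0"
    using p q by (simp_all add: hyperbolic_spaceD)
  obtain x :: "real ^ 'm" where "x \<noteq> 0"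
    and x: "orthogonal (snd q *\<^sub>R fst p - snd p *\<^sub>R fst q) x"
    using orthogonal_to_vector_exists[of "snd q *\<^sub>R fst p - snd p *\<^sub>R fst q"] assms(3)
    by auto
  define w where "w = (x, fst p \<bullet> x / snd p)"
  have "w \<noteq> 0"
    using \<open>x \<noteq> 0\<close> by (simp add: w_def zero_prod_def)
  have pw: "lorentz p w = 0"
    using t by (simp add: w_def lorentz_def)
  have qw: "lorentz q w = 0"
    using t x by (simp add: w_def lorentz_def orthogonal_def inner_diff_left field_simps)
  have ww: "lorentz w w > 0"
    by (rule lorentz_orthogonal_pos[OF p pw \<open>w \<noteq> 0\<close>])
  define e where "e = (1 / sqrt (lorentz w w)) *\<^sub>R w"
  have "lorentz e e = 1"
    using ww by (simp add: e_def lorentz_bilinear field_simps)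
  moreover have "lorentz p e = 0" "lorentz q e = 0"
    by (simp_all add: e_def lorentz_bilinear pw qw)
  ultimately show ?thesis by (rule that[rotated 2])
qed

text \<open>
  The vertex is sought as \<open>r = \<alpha> p + \<beta> q + \<gamma> e\<close> with \<open>e\<close> a unit vector orthogonal to \<open>p\<close> and
  \<open>q\<close>. The two distances are linear conditions on \<open>\<alpha>\<close> and \<open>\<beta>\<close>, solvable since \<open>p\<close> and \<open>q\<close> are
  distinct, and the condition \<open>lorentz r r = -1\<close> then gives the value of \<open>\<gamma>\<^sup>2\<close>. That value is
  nonnegative exactly if \<open>cosh (x - d) \<le> cosh y \<le> cosh (x + d)\<close> where \<open>d = hyp_dist p q\<close>.
\<close>

lemma exists_hyperbolic_triangle:
  fixes p q :: "(real ^ 'm) \<times> real"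
  assumes p: "p \<in> hyperbolic_space" and q: "q \<in> hyperbolic_space" and card: "CARD('m) \<ge> 2"
    and d: "hyp_dist p q > 0"
    and ineq: "\<bar>x - hyp_dist p q\<bar> \<le> y" "y \<le> x + hyp_dist p q" and "x \<ge> 0"
  obtains r where "r \<in> hyperbolic_space" "hyp_dist p r = x" "hyp_dist r q = y"
proof -
  let ?d = "hyp_dist p q"
  define a b c where "a = cosh x" and "b = cosh y" and "c = cosh ?d"
  have "y \<ge> 0" using ineq by linarith
  have pp: "lorentz p p = -1" "lorentz q q = -1" "lorentz p q = -c" "lorentz q p = -c"
    using p q cosh_hyp_dist[OF p q] by (simp_all add: hyperbolic_spaceD c_def lorentz_commute[of q p])
  have "cosh 0 < c"
    unfolding c_def using d by (subst cosh_real_nonneg_less_iff) auto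
  then have "c\<^sup>2 > 1"
    by (simp add: one_less_power)
  have "cosh (x - ?d) \<le> b"
    unfolding b_def using ineq \<open>y \<ge> 0\<close>
    by (metis abs_ge_zero cosh_real_abs cosh_real_nonneg_le_iff)
  moreover have "b \<le> cosh (x + ?d)"
    unfolding b_def using ineq \<open>y \<ge> 0\<close> \<open>x \<ge> 0\<close> d by (subst cosh_real_nonneg_le_iff) auto
  ultimately have "\<bar>a * c - b\<bar> \<le> sinh x * sinh ?d"
    by (simp add: a_def c_def cosh_add cosh_diff abs_le_iff)
  then have "(a * c - b)\<^sup>2 \<le> (sinh x * sinh ?d)\<^sup>2"
    by (metis abs_ge_zero power2_abs power_mono)
  then have gram: "0 \<le> (a\<^sup>2 - 1) * (c\<^sup>2 - 1) - (a * c - b)\<^sup>2"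
    by (simp add: a_def c_def power_mult_distrib sinh_square_eq)
  obtain e where e: "lorentz p e = 0" "lorentz q e = 0" "lorentz e e = 1"
    using exists_unit_orthogonal[OF p q card] .
  \<comment> \<open>The solution of \<open>\<alpha> + \<beta> * c = a\<close> and \<open>\<alpha> * c + \<beta> = b\<close>.\<close>
  define \<alpha> \<beta> where "\<alpha> = (b * c - a) / (c\<^sup>2 - 1)" and "\<beta> = (a * c - b) / (c\<^sup>2 - 1)"
  define \<gamma> where "\<gamma> = sqrt (((a\<^sup>2 - 1) * (c\<^sup>2 - 1) - (a * c - b)\<^sup>2) / (c\<^sup>2 - 1))"
  define r where "r = \<alpha> *\<^sub>R p + \<beta> *\<^sub>R q + \<gamma> *\<^sub>R e"
  have ab: "\<alpha> + \<beta> * c = a" "\<alpha> * c + \<beta> = b"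
    using \<open>c\<^sup>2 > 1\<close> by (simp_all add: \<alpha>_def \<beta>_def divide_simps) (simp_all add: algebra_simps power2_eq_square)
  have pr: "lorentz p r = - a" and qr: "lorentz q r = - b"
    using ab by (simp_all add: r_def lorentz_bilinear pp e)
  have er: "lorentz e r = \<gamma>"
    using e by (simp add: r_def lorentz_bilinear lorentz_commute[of e p] lorentz_commute[of e q])
  have "\<gamma>\<^sup>2 = ((a\<^sup>2 - 1) * (c\<^sup>2 - 1) - (a * c - b)\<^sup>2) / (c\<^sup>2 - 1)"
    unfolding \<gamma>_def using gram \<open>c\<^sup>2 > 1\<close> by simp
  also have "\<dots> = \<alpha> * a + \<beta> * b - 1"
    using \<open>c\<^sup>2 > 1\<close> by (simp add: \<alpha>_def \<beta>_def divide_simps) (simp add: algebra_simps power2_eq_square)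
  finally have \<gamma>: "\<gamma>\<^sup>2 = \<alpha> * a + \<beta> * b - 1" .
  have "lorentz r r = \<alpha> * lorentz p r + \<beta> * lorentz q r + \<gamma> * lorentz e r"
    by (subst r_def) (simp add: lorentz_bilinear)
  also have "\<dots> = -1"
    using \<gamma> by (simp add: pr qr er power2_eq_square)
  finally have rr: "lorentz r r = -1" .
  \<comment> \<open>On the lower sheet, \<open>r\<close> would have a positive product with \<open>p\<close>, contradicting \<open>pr\<close>.\<close>
  have "snd r > 0"
  proof (rule ccontr)
    assume neg: "\<not> snd r > 0"
    have "snd r \<noteq> 0"
    proof
      assume "snd r = 0"
      then have "lorentz r r \<ge> 0" by (simp add: lorentz_def)
      with rr show False by simp
    qed
    with neg rr have "- r \<in> hyperbolic_space"
      by (simp add: hyperbolic_space_def lorentz_def)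
    from lorentz_neg[OF p this] have "lorentz p r > 0"
      by (simp add: lorentz_def)
    with pr show False
      using cosh_real_pos[of x] by (simp add: a_def)
  qed
  then have "r \<in> hyperbolic_space"
    using rr by (simp add: hyperbolic_space_def)
  moreover have "hyp_dist p r = x"
    using pr \<open>x \<ge> 0\<close> by (intro hyp_dist_eqI) (simp_all add: a_def)
  moreover have "hyp_dist r q = y"
    using qr \<open>y \<ge> 0\<close> by (intro hyp_dist_eqI) (simp_all add: b_def lorentz_commute[of r q])
  ultimately show ?thesis by (rule that)
qed

lemma exists_hyp_dist:
  assumes "d \<ge> 0"
  obtains p q :: "(real ^ 'm) \<times> real"
  where "p \<in> hyperbolic_space" "q \<in> hyperbolic_space" "hyp_dist p q = d"
proof -
  obtain u :: "real ^ 'm" where u: "norm u = 1"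
    using vector_choose_size[of 1] by auto
  define p q :: "(real ^ 'm) \<times> real" where "p = (0, 1)" and "q = (sinh d *\<^sub>R u, cosh d)"
  have "u \<bullet> u = 1"
    using u by (simp add: norm_eq_1)
  then have "lorentz q q = -1"
    using cosh_square_eq[of d] by (simp add: q_def lorentz_def power2_eq_square)
  then have "q \<in> hyperbolic_space"
    by (simp add: hyperbolic_space_def q_def)
  moreover have "p \<in> hyperbolic_space"
    by (simp add: hyperbolic_space_def p_def lorentz_def)
  moreover have "hyp_dist p q = d"
    using assms by (intro hyp_dist_eqI) (simp_all add: p_def q_def lorentz_def)
  ultimately show ?thesis using that by blast
qed

section \<open>Paths with prescribed steps\<close>

text \<open>
  The last two hypotheses are the polygon inequalities for the step lengths together with the length
  of the closing side from \<open>p\<close> to \<open>q\<close>. The closing side has positive length because the triangle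
  construction needs distinct base points.
\<close>

lemma exists_hyperbolic_path:
  fixes p q :: "(real ^ 'm) \<times> real"
  assumes card: "CARD('m) \<ge> 2"
    and "k \<ge> 1" and "p \<in> hyperbolic_space" and "q \<in> hyperbolic_space"
    and "hyp_dist p q > 0" and "\<And>i. i < k \<Longrightarrow> L i > 0"
    and "hyp_dist p q \<le> (\<Sum>i<k. L i)"
    and "\<And>i. i < k \<Longrightarrow> 2 * L i \<le> hyp_dist p q + (\<Sum>j<k. L j)"
  shows "\<exists>f. f 0 = p \<and> f k = q \<and> (\<forall>i\<le>k. f i \<in> hyperbolic_space) \<and>
    (\<forall>i<k. hyp_dist (f i) (f (Suc i)) = L i)"
  using assms(2-)
proof (induction k arbitrary: q rule: nat_induct_at_least)
  case base
  have "hyp_dist p q = L 0"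
    using base(5) base(6)[of 0] by simp
  then show ?case
    using base by (intro exI[of _ "\<lambda>i. if i = 0 then p else q"]) auto
next
  case (Suc k)
  let ?d = "hyp_dist p q" and ?S = "\<Sum>i<k. L i"
  \<comment> \<open>The largest distance from \<open>p\<close> that the triangle inequality and the first \<open>k\<close> steps both allow.
    All other conditions on \<open>x\<close> are lower bounds, so this is the best choice.\<close>
  define x where "x = min (?d + L k) ?S"
  have S: "(\<Sum>i<Suc k. L i) = ?S + L k" by simp
  have Lk: "L k > 0" "2 * L k \<le> ?d + (?S + L k)"
    using Suc.prems(4,6)[of k] by simp_all
  have "?S > 0"
    using Suc.hyps Suc.prems(4) by (intro sum_pos) (auto simp: lessThan_empty_iff)
  have x: "x > 0" "\<bar>x - ?d\<bar> \<le> L k" "L k \<le> x + ?d"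
    using \<open>?S > 0\<close> Lk Suc.prems(3,5) unfolding x_def S by linarith+
  obtain r where r: "r \<in> hyperbolic_space" "hyp_dist p r = x" "hyp_dist r q = L k"
    using exists_hyperbolic_triangle[OF Suc.prems(1,2) card Suc.prems(3) x(2,3)] x(1) by auto
  have "\<exists>f. f 0 = p \<and> f k = r \<and> (\<forall>i\<le>k. f i \<in> hyperbolic_space) \<and>
    (\<forall>i<k. hyp_dist (f i) (f (Suc i)) = L i)"
  proof (rule Suc.IH)
    show "p \<in> hyperbolic_space" "r \<in> hyperbolic_space" "hyp_dist p r > 0"
      using Suc.prems r x by simp_all
    show "L i > 0" if "i < k" for i
      using that Suc.prems(4) by simp
    show "hyp_dist p r \<le> ?S"
      by (simp add: r x_def)
    show "2 * L i \<le> hyp_dist p r + ?S" if "i < k" for i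
    proof -
      have "L i \<le> ?S"
        using that Suc.prems(4) by (intro member_le_sum) (auto simp: less_imp_le)
      moreover have "2 * L i \<le> ?d + (?S + L k)"
        using Suc.prems(6)[of i] that by simp
      ultimately show ?thesis unfolding r x_def by linarith
    qed
  qed
  then obtain f where "f 0 = p" "f k = r" "\<forall>i\<le>k. f i \<in> hyperbolic_space"
    "\<forall>i<k. hyp_dist (f i) (f (Suc i)) = L i"
    by blast
  then show ?case
    using r Suc.prems(2) by (intro exI[of _ "f(Suc k := q)"]) (auto simp: less_Suc_eq le_Suc_eq)
qed

section \<open>Polygons\<close>

lemma sum_mod_shift:
  fixes g :: "nat \<Rightarrow> real"
  shows "(\<Sum>i<n. g ((k + i) mod n)) = (\<Sum>i<n. g i)"
proof (induction k)
  case 0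
  show ?case by (intro sum.cong) simp_all
next
  case (Suc k)
  have "(\<Sum>i<n. g ((Suc k + i) mod n)) + g (k mod n) = (\<Sum>i<Suc n. g ((k + i) mod n))"
    by (subst sum.lessThan_Suc_shift) simp
  also have "\<dots> = (\<Sum>i<n. g ((k + i) mod n)) + g (k mod n)"
    by simp
  finally show ?case using Suc by simp
qed

text \<open>
  Numbering the vertices from the end of side \<open>k\<close> on makes the rest of the polygon a path
  \<open>f 0, \<dots>, f (n - 1)\<close> from the end of side \<open>k\<close> back to its start.
\<close>

lemma sidelength_le_sum_others:
  assumes Z: "hyp_polygon n Z" and "k < n"
  shows "sidelength Z k \<le> (\<Sum>j\<in>{..<n} - {k}. sidelength Z j)"
proof -
  have len: "length Z = n" and H: "\<And>i. i < n \<Longrightarrow> Z ! i \<in> hyperbolic_space"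
    using Z by (auto simp: hyp_polygon_def)
  define f where "f i = Z ! ((Suc k + i) mod n)" for i
  have f: "f i \<in> hyperbolic_space" for i
    unfolding f_def using \<open>k < n\<close> by (intro H) simp
  have step: "hyp_dist (f i) (f (Suc i)) = sidelength Z ((Suc k + i) mod n)" for i
    by (simp add: f_def sidelength_def len mod_Suc_eq)
  obtain m where m: "n = Suc m" using \<open>k < n\<close> by (cases n) auto
  have "Suc k + m = k + n" using m by simp
  then have last: "(Suc k + m) mod n = k"
    using \<open>k < n\<close> by (simp only: mod_add_self2 mod_less)
  then have "sidelength Z k = hyp_dist (f 0) (f m)"
    using \<open>k < n\<close>
    by (simp add: f_def sidelength_def len hyp_dist_commute)
  also have "\<dots> \<le> (\<Sum>i<m. hyp_dist (f i) (f (Suc i)))"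
    by (rule hyp_dist_le_path) (rule f)
  also have "\<dots> = (\<Sum>i<n. sidelength Z ((Suc k + i) mod n)) - sidelength Z k"
    using last by (simp add: m step)
  also have "\<dots> = (\<Sum>j\<in>{..<n} - {k}. sidelength Z j)"
    using \<open>k < n\<close> by (simp add: sum_mod_shift[of _ "Suc k" n] sum_diff1 del: add_Suc)
  finally show ?thesis .
qed

theorem corollary5p4:
  fixes n :: nat and L :: "nat \<Rightarrow> real"
  assumes "n \<ge> 3"
    and "\<And>k. k < n \<Longrightarrow> L k > 0"
    and "CARD('m::finite) \<ge> 2"
  shows "(\<forall>k<n. L k \<le> (\<Sum>j\<in>{..<n} - {k}. L j)) \<longleftrightarrow>
    (\<exists>Z :: ((real ^ 'm) \<times> real) list. hyp_polygon n Z \<and> (\<forall>k<n. sidelength Z k = L k))"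
proof
  assume ineq: "\<forall>k<n. L k \<le> (\<Sum>j\<in>{..<n} - {k}. L j)"
  obtain m where m: "n = Suc m" "m \<ge> 1"
    using \<open>n \<ge> 3\<close> by (cases n) auto
  have twice: "2 * L k \<le> L m + (\<Sum>j<m. L j)" if "k < n" for k
    using ineq that by (auto simp: sum_diff1 m)
  have longest: "L m \<le> (\<Sum>j<m. L j)"
    using twice[of m] m by simp
  have "L m > 0" using assms(2) m by simp
  obtain p q :: "(real ^ 'm) \<times> real"
    where pq: "p \<in> hyperbolic_space" "q \<in> hyperbolic_space" "hyp_dist p q = L m"
    using exists_hyp_dist[OF less_imp_le[OF \<open>L m > 0\<close>]] .
  have "\<exists>f. f 0 = p \<and> f m = q \<and> (\<forall>i\<le>m. f i \<in> hyperbolic_space) \<and>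
    (\<forall>i<m. hyp_dist (f i) (f (Suc i)) = L i)"
    using pq m assms(2) \<open>L m > 0\<close> longest twice
    by (intro exists_hyperbolic_path[OF assms(3)]) auto
  then obtain f where f: "f 0 = p" "f m = q" "\<And>i. i \<le> m \<Longrightarrow> f i \<in> hyperbolic_space"
    "\<And>i. i < m \<Longrightarrow> hyp_dist (f i) (f (Suc i)) = L i"
    by blast
  define Z where "Z = map f [0..<n]"
  have nth: "Z ! i = f i" if "i < n" for i
    using that by (simp add: Z_def del: upt_Suc)
  have side: "sidelength Z k = L k" if "k < n" for k
  proof (cases "k = m")
    case True
    then show ?thesis
      using pq f m nth by (simp add: sidelength_def Z_def hyp_dist_commute del: upt_Suc)
  next
    case False
    then show ?thesis
      using that f m by (simp add: sidelength_def Z_def del: upt_Suc)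
  qed
  have "Z ! k \<noteq> Z ! (Suc k mod n)" if "k < n" for k
  proof
    assume "Z ! k = Z ! (Suc k mod n)"
    then have "sidelength Z k = 0"
      using that f(3)[of k] nth[OF that] m
      by (simp add: sidelength_def Z_def hyp_dist_self del: upt_Suc)
    then show False using side[OF that] assms(2)[OF that] by simp
  qed
  then have "hyp_polygon n Z"
    using f(3) m by (auto simp: hyp_polygon_def Z_def)
  then show "\<exists>Z :: ((real ^ 'm) \<times> real) list. hyp_polygon n Z \<and> (\<forall>k<n. sidelength Z k = L k)"
    using side by blast
next
  assume "\<exists>Z :: ((real ^ 'm) \<times> real) list. hyp_polygon n Z \<and> (\<forall>k<n. sidelength Z k = L k)"
  then obtain Z :: "((real ^ 'm) \<times> real) list"
    where Z: "hyp_polygon n Z" and side: "\<And>k. k < n \<Longrightarrow> sidelength Z k = L k"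
    by blast
  show "\<forall>k<n. L k \<le> (\<Sum>j\<in>{..<n} - {k}. L j)"
  proof (intro allI impI)
    fix k assume "k < n"
    have "(\<Sum>j\<in>{..<n} - {k}. sidelength Z j) = (\<Sum>j\<in>{..<n} - {k}. L j)"
      by (intro sum.cong) (simp_all add: side)
    then show "L k \<le> (\<Sum>j\<in>{..<n} - {k}. L j)"
      using sidelength_le_sum_others[OF Z \<open>k < n\<close>] side[OF \<open>k < n\<close>] by simp
  qed
qed

end
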